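(* The mapping $\Theta:\mathbb R\times M\times\mathcal S(M)\to X$, $\Theta(s,x,\varphi)=\ell((\varphi^{s,x}_k:k\in\mathbb N))$, is measurable and satisfies the following properties for all $(s,\varphi)\in\mathbb R\times\mathcal S(M)$: (a) for all $x\in M$, $\Theta(s,x,\varphi)\in C([s,\infty):M)$ and $\Theta(s,x,\varphi)(s)=x$; (b) for all $n\in I^s$, $\Theta(s,\varphi_n(s),\varphi)=\varphi_n[s,\infty)$.
   Context: $(M,\rho)$ is a locally compact separable metric space, with $\rho$ complete and all bounded sets relatively compact. Path space. $X=\bigcup_{s\in\mathbb R}C([s,\infty):M)$; for $f\in C([s,\infty):M)$ write $i(f)=s$ and $e(f)(t)=f(s\vee t)$, $t\in\mathbb R$. $X$ carries the complete separable metric $d(f,g)=|i(f)-i(g)|+\delta(e(f),e(g))$, where $\delta$ is a metric for uniform convergence on compacts on $C(\mathbb R:M)$, and its Borel $\sigma$-field. For an interval $I$, $fI$ denotes the restriction of $e(f)$ to $I$. Skeletons. For $\varphi=(\varphi_n)\in X^{\mathbb N}$ put $s_n=i(\varphi_n)$, $x_n=\varphi_n(s_n)$, $I^s=\{n:s_n\le s\}$. $\varphi$ is a skeleton ($\varphi\in\mathcal S(M)$) if: (1) whenever $m,n\in I^s$ and $\varphi_m(s)=\varphi_n(s)$, then $\varphi_m(t)=\varphi_n(t)$ for all $t\ge s$; (2) $\{(s_n,x_n):n\in\mathbb N\}$ is dense in $\mathbb R\times M$; (3) for every compact $L\subset\mathbb R\times M$ the set $\{\varphi_n[s,\infty):n\in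 I^s,(s,\varphi_n(s))\in L\}$ is relatively compact in $X$. $\mathcal S(M)$ carries the $\sigma$-field induced from the product $\sigma$-field of $X^{\mathbb N}$. Data in $\Theta$. $\ell:X^{\mathbb N}\to X$ is a fixed measurable map such that for each relatively compact sequence $(f_n)$ in $X$, $\ell((f_n))$ is a limit point of $(f_n)$. $\varepsilon_k:M\to(0,\infty)$, $k\in\mathbb N$, are fixed measurable functions such that for each $x$ the sequence $(\varepsilon_k(x))_k$ is non-increasing with limit $0$. $n^{s,x}_k=\inf\{n\in I^s:\rho(\varphi_n(s),x)<\varepsilon_k(x)\}$ (which is always finite) and $\varphi^{s,x}_k=\varphi_{n^{s,x}_k}[s,\infty)$. *)

theory Defs
  imports "HOL-Analysis.Analysis"
begin

text \<open>
  The state space \<open>M\<close> is a type of the classes \<^class>\<open>polish_space\<close> (its metric \<^const>\<open>dist\<close> is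
  complete, its topology second countable) and \<^class>\<open>heine_borel\<close> (bounded sets are relatively
  compact, hence \<open>M\<close> is locally compact).

  An element of the path space is a starting time \<open>s\<close> together with a continuous function on
  \<open>[s,\<infinity>)\<close>; extensionality on \<open>{s..}\<close> makes the representation unique.
\<close>

typedef (overloaded) ('m::topological_space) path =
  "{(s :: real, f :: real \<Rightarrow> 'm). f \<in> extensional {s..} \<and> continuous_on {s..} f}"
proof -
  have "(0, restrict (\<lambda>_. undefined) {0..})
      \<in> {(s :: real, f :: real \<Rightarrow> 'm). f \<in> extensional {s..} \<and> continuous_on {s..} f}"
    by (auto cong: continuous_on_cong)
  then show ?thesis by blast
qed

definition start :: "'m::topological_space path \<Rightarrow> real" where
  "start f = fst (Rep_path f)"

text \<open>The value \<open>f(t)\<close>, meaningful only for \<open>t \<ge> start f\<close>.\<close>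

definition val :: "'m::topological_space path \<Rightarrow> real \<Rightarrow> 'm" where
  "val f = snd (Rep_path f)"

text \<open>The extension \<open>e(f)\<close>.\<close>

definition extend :: "'m::topological_space path \<Rightarrow> real \<Rightarrow> 'm" where
  "extend f t = val f (max (start f) t)"

text \<open>The restriction \<open>f[s,\<infinity>)\<close> of \<open>e(f)\<close>; it is defined also for \<open>s < start f\<close>.\<close>

definition restr :: "'m::topological_space path \<Rightarrow> real \<Rightarrow> 'm path" where
  "restr f s = Abs_path (s, restrict (extend f) {s..})"

definition continuous_funs :: "(real \<Rightarrow> 'm::topological_space) set" where
  "continuous_funs = {g. continuous_on UNIV g}"

text \<open>
  \<open>\<delta>\<close> is a metric on \<open>C(\<real>:M)\<close> inducing uniform convergence on compacts. Metric topologies are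
  determined by their convergent sequences, so this fixes the topology, but not the metric.
\<close>

definition compact_convergence_metric :: "(real \<Rightarrow> 'm::metric_space) metric \<Rightarrow> bool" where
  "compact_convergence_metric \<delta> \<longleftrightarrow>
     mspace \<delta> = continuous_funs \<and>
     (\<forall>g l. (\<forall>n. g n \<in> continuous_funs) \<and> l \<in> continuous_funs \<longrightarrow>
        (limitin (mtopology_of \<delta>) g l sequentially \<longleftrightarrow>
         (\<forall>K. compact K \<longrightarrow> uniform_limit K g l sequentially)))"

definition path_metric ::
  "(real \<Rightarrow> 'm::metric_space) metric \<Rightarrow> 'm path metric" where
  "path_metric \<delta> =
     metric (UNIV, \<lambda>f g. \<bar>start f - start g\<bar> + mdist \<delta> (extend f) (extend g))"

abbreviation path_topology ::
  "(real \<Rightarrow> 'm::metric_space) metric \<Rightarrow> 'm path topology" where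
  "path_topology \<delta> \<equiv> mtopology_of (path_metric \<delta>)"

definition path_borel ::
  "(real \<Rightarrow> 'm::metric_space) metric \<Rightarrow> 'm path measure" where
  "path_borel \<delta> = sigma UNIV {U. openin (path_topology \<delta>) U}"

definition relatively_compact_in :: "'a topology \<Rightarrow> 'a set \<Rightarrow> bool" where
  "relatively_compact_in T S \<longleftrightarrow> S \<subseteq> topspace T \<and> compactin T (T closure_of S)"

text \<open>Limit points of a sequence (not of its range) are its subsequential limits.\<close>

definition seq_limit_point :: "'a topology \<Rightarrow> (nat \<Rightarrow> 'a) \<Rightarrow> 'a \<Rightarrow> bool" where
  "seq_limit_point T f l \<longleftrightarrow>
     (\<exists>r :: nat \<Rightarrow> nat. strict_mono r \<and> limitin T (f \<circ> r) l sequentially)"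

definition started :: "(nat \<Rightarrow> 'm::topological_space path) \<Rightarrow> real \<Rightarrow> nat set" where
  "started \<phi> s = {n. start (\<phi> n) \<le> s}"

definition skeletons ::
  "(real \<Rightarrow> 'm::metric_space) metric \<Rightarrow> (nat \<Rightarrow> 'm path) set" where
  "skeletons \<delta> = {\<phi>.
     (\<forall>s. \<forall>m \<in> started \<phi> s. \<forall>n \<in> started \<phi> s.
        val (\<phi> m) s = val (\<phi> n) s \<longrightarrow> (\<forall>t\<ge>s. val (\<phi> m) t = val (\<phi> n) t)) \<and>
     closure (range (\<lambda>n. (start (\<phi> n), val (\<phi> n) (start (\<phi> n))))) = UNIV \<and>
     (\<forall>L :: (real \<times> 'm) set. compact L \<longrightarrow>
        relatively_compact_in (path_topology \<delta>)
          {restr (\<phi> n) s | n s. n \<in> started \<phi> s \<and> (s, val (\<phi> n) s) \<in> L})}"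

definition path_seq_space ::
  "(real \<Rightarrow> 'm::metric_space) metric \<Rightarrow> (nat \<Rightarrow> 'm path) measure" where
  "path_seq_space \<delta> = (\<Pi>\<^sub>M n\<in>UNIV. path_borel \<delta>)"

definition skeleton_space ::
  "(real \<Rightarrow> 'm::metric_space) metric \<Rightarrow> (nat \<Rightarrow> 'm path) measure" where
  "skeleton_space \<delta> = restrict_space (path_seq_space \<delta>) (skeletons \<delta>)"

text \<open>
  The index \<open>n\<^sub>k\<close> at \<open>(s,x)\<close>. For a skeleton the set is nonempty when the radius is positive;
  otherwise \<^const>\<open>Inf\<close> on \<^typ>\<open>nat\<close> would return an arbitrary value.
\<close>

definition index ::
  "(nat \<Rightarrow> 'm::metric_space \<Rightarrow> real) \<Rightarrow> real \<Rightarrow> 'm \<Rightarrow> (nat \<Rightarrow> 'm path) \<Rightarrow> nat \<Rightarrow> nat" where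
  "index \<epsilon> s x \<phi> k = Inf {n \<in> started \<phi> s. dist (val (\<phi> n) s) x < \<epsilon> k x}"

definition Theta ::
  "((nat \<Rightarrow> 'm::metric_space path) \<Rightarrow> 'm path) \<Rightarrow> (nat \<Rightarrow> 'm \<Rightarrow> real) \<Rightarrow>
   real \<Rightarrow> 'm \<Rightarrow> (nat \<Rightarrow> 'm path) \<Rightarrow> 'm path" where
  "Theta lp \<epsilon> s x \<phi> = lp (\<lambda>k. restr (\<phi> (index \<epsilon> s x \<phi> k)) s)"


text \<open>\<^const>\<open>path_metric\<close> and \<^const>\<open>restr\<close> are well defined.\<close>

lemma continuous_on_val: "continuous_on {start f..} (val f)"
  using Rep_path[of f] by (auto simp: start_def val_def split: prod.splits)

lemma continuous_on_extend: "continuous_on UNIV (extend f)"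
proof -
  have "continuous_on UNIV (val f \<circ> (\<lambda>t. max (start f) t))"
    by (rule continuous_on_compose)
       (auto intro!: continuous_intros continuous_on_subset[OF continuous_on_val])
  then show ?thesis by (simp add: extend_def[abs_def] o_def)
qed

lemma extend_in_continuous_funs: "extend f \<in> continuous_funs"
  by (simp add: continuous_funs_def continuous_on_extend)

lemma path_eqI:
  assumes "start f = start g" "extend f = extend g"
  shows "f = g"
proof -
  have "val f t = val g t" for t
  proof (cases "start f \<le> t")
    case True
    then show ?thesis
      using fun_cong[OF assms(2), of t] assms(1) by (simp add: extend_def)
  next
    case False
    then show ?thesis
      using Rep_path[of f] Rep_path[of g] assms(1)
      by (auto simp: start_def val_def extensional_def split: prod.splits)
  qed
  then have "Rep_path f = Rep_path g"
    using assms(1) by (auto simp: start_def val_def prod_eq_iff)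
  then show ?thesis by (simp add: Rep_path_inject)
qed

lemma Rep_restr: "Rep_path (restr f s) = (s, restrict (extend f) {s..})"
proof -
  have "continuous_on {s..} (restrict (extend f) {s..})"
    by (rule continuous_on_eq[OF continuous_on_subset[OF continuous_on_extend[of f]]]) auto
  then show ?thesis unfolding restr_def by (subst Abs_path_inverse) auto
qed

lemma start_restr [simp]: "start (restr f s) = s"
  by (simp add: start_def Rep_restr)

lemma val_restr: "s \<le> t \<Longrightarrow> val (restr f s) t = extend f t"
  by (simp add: val_def Rep_restr)

lemma
  assumes "mspace \<delta> = continuous_funs"
  shows mspace_path_metric: "mspace (path_metric \<delta>) = UNIV"
    and mdist_path_metric: "mdist (path_metric \<delta>) f g =
      \<bar>start f - start g\<bar> + mdist \<delta> (extend f) (extend g)"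
proof -
  interpret D: Metric_space "mspace \<delta>" "mdist \<delta>"
    by (rule Metric_space_mspace_mdist)
  have e: "extend h \<in> mspace \<delta>" for h
    using extend_in_continuous_funs assms by auto
  have "Metric_space UNIV (\<lambda>f g. \<bar>start f - start g\<bar> + mdist \<delta> (extend f) (extend g))"
  proof
    fix f g h
    show "\<bar>start f - start h\<bar> + mdist \<delta> (extend f) (extend h)
        \<le> \<bar>start f - start g\<bar> + mdist \<delta> (extend f) (extend g)
          + (\<bar>start g - start h\<bar> + mdist \<delta> (extend g) (extend h))"
      using D.triangle[OF e[of f] e[of g] e[of h]] by linarith
    have "f = g" if "\<bar>start f - start g\<bar> + mdist \<delta> (extend f) (extend g) = 0"
    proof (rule path_eqI)
      have "0 \<le> mdist \<delta> (extend f) (extend g)" by simp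
      with that have "\<bar>start f - start g\<bar> = 0" "mdist \<delta> (extend f) (extend g) = 0"
        by linarith+
      then show "start f = start g" "extend f = extend g"
        using D.zero[OF e e] by auto
    qed
    then show "(\<bar>start f - start g\<bar> + mdist \<delta> (extend f) (extend g) = 0) = (f = g)"
      using D.zero[OF e e, of f f] by auto
  qed (auto simp: D.commute)
  then show "mspace (path_metric \<delta>) = UNIV"
    and "mdist (path_metric \<delta>) f g = \<bar>start f - start g\<bar> + mdist \<delta> (extend f) (extend g)"
    by (simp_all add: path_metric_def Metric_space.mspace_metric Metric_space.mdist_metric)
qed

end

theory Submission
  imports Defs
begin

text \<open>
  The paths \<open>\<phi>\<^sub>n[s,\<infinity>)\<close> selected at \<open>(s,x)\<close> pass through a fixed compact set at time \<open>s\<close>, so condition (3)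
  makes them relatively compact and \<open>\<ell>\<close> picks one of their subsequential limits, which starts at time
  \<open>s\<close> in \<open>lim \<phi>\<^sub>n(s) = x\<close>. If \<open>x = \<phi>\<^sub>n(s)\<close>, the selected indices are bounded by \<open>n\<close>, so eventually the
  selected path passes through \<open>x\<close> and coincides with \<open>\<phi>\<^sub>n[s,\<infinity>)\<close> by coalescence.

  For measurability, \<open>(f,s) \<mapsto> f(s)\<close> and \<open>(f,s) \<mapsto> f[s,\<infinity>)\<close> are Caratheodory maps: they are limits of the
  maps obtained by rounding \<open>s\<close> to a grid, which are countably many continuous functions of \<open>f\<close>
  pasted together. The selected index is a least index satisfying a measurable condition.
\<close>

section \<open>Measurability of pointwise limits in a metric space\<close>

text \<open>The path metric depends on \<open>\<delta>\<close> and is a value of type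
  \<open>metric\<close>, not a type-class instance. Limits of measurable path-valued maps therefore
  need this version of the classical result.\<close>

lemma measurable_limitin_metric:
  fixes m :: "'b metric" and f :: "nat \<Rightarrow> 'a \<Rightarrow> 'b"
  defines "N \<equiv> sigma (mspace m) {U. openin (mtopology_of m) U}"
  assumes f: "\<And>n. f n \<in> M \<rightarrow>\<^sub>M N"
    and lim: "\<And>x. x \<in> space M \<Longrightarrow> limitin (mtopology_of m) (\<lambda>n. f n x) (g x) sequentially"
  shows "g \<in> M \<rightarrow>\<^sub>M N"
proof -
  interpret m: Metric_space "mspace m" "mdist m"
    by (rule Metric_space_mspace_mdist)
  have top: "m.mtopology = mtopology_of m"
    by (simp add: mtopology_of_def)
  have sub: "{U. openin (mtopology_of m) U} \<subseteq> Pow (mspace m)"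
    using openin_subset by fastforce
  have spN: "space N = mspace m"
    using sub by (simp add: N_def)
  have setsN: "U \<in> sets N" if "openin (mtopology_of m) U" for U
    using that sub by (simp add: N_def)
  have g: "g x \<in> mspace m" if "x \<in> space M" for x
    using lim[OF that] by (simp add: limitin_def)
  have fm: "f n x \<in> mspace m" if "x \<in> space M" for n x
    using measurable_space[OF f that] spN by simp
  have conv: "\<forall>\<^sub>F n in sequentially. mdist m (f n x) (g x) < e" if "x \<in> space M" "e > 0" for x e
    using lim[OF that(1)] that(2) unfolding top[symmetric] m.limitin_metric
    by (auto elim: eventually_mono)
  show ?thesis
    unfolding N_def
  proof (rule measurable_measure_of[OF sub])
    show "g \<in> space M \<rightarrow> mspace m"
      using g by auto
    fix U assume "U \<in> {U. openin (mtopology_of m) U}"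
    then have U: "openin m.mtopology U"
      by (simp add: top)
    \<comment> \<open>\<open>W k\<close> is the open \<open>1/(k+1)\<close>-neighbourhood of the complement of \<open>U\<close>; membership of the limit in
      the open set \<open>U\<close> means that the sequence eventually avoids some \<open>W k\<close>.\<close>
    define W where "W k = (\<Union>z \<in> mspace m - U. m.mball z (inverse (Suc k)))" for k
    have W: "W k \<in> sets N" for k
      unfolding W_def by (intro setsN, unfold top[symmetric]) auto
    have "(g x \<in> U) = (\<exists>k i. \<forall>n\<ge>i. f n x \<notin> W k)" if x: "x \<in> space M" for x
    proof
      assume "g x \<in> U"
      then obtain r where r: "r > 0" "m.mball (g x) r \<subseteq> U"
        using U by (auto simp: m.openin_mtopology)
      obtain k where k: "inverse (Suc k) < r / 2"
        using reals_Archimedean[of "r/2"] r by auto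
      obtain i where i: "\<And>n. n \<ge> i \<Longrightarrow> mdist m (f n x) (g x) < r / 2"
        using conv[OF x, of "r/2"] r by (auto simp: eventually_sequentially)
      have "f n x \<notin> W k" if "n \<ge> i" for n
      proof
        assume "f n x \<in> W k"
        then obtain z where z: "z \<in> mspace m" "z \<notin> U" "mdist m z (f n x) < inverse (Suc k)"
          by (auto simp: W_def)
        have "mdist m z (g x) \<le> mdist m z (f n x) + mdist m (f n x) (g x)"
          using m.triangle z(1) fm g x by blast
        then have "mdist m (g x) z < r"
          using z(3) i[OF that] k by (simp add: m.commute)
        then show False
          using r(2) z g[OF x] by (auto simp: subset_iff)
      qed
      then show "\<exists>k i. \<forall>n\<ge>i. f n x \<notin> W k" by blast
    next
      assume "\<exists>k i. \<forall>n\<ge>i. f n x \<notin> W k"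
      then obtain k i where ki: "\<And>n. n \<ge> i \<Longrightarrow> f n x \<notin> W k" by blast
      obtain j where j: "\<And>n. n \<ge> j \<Longrightarrow> mdist m (f n x) (g x) < inverse (Suc k)"
        using conv[OF x, of "inverse (Suc k)"] by (auto simp: eventually_sequentially)
      show "g x \<in> U"
      proof (rule ccontr)
        \<comment> \<open>A limit outside \<open>U\<close> would itself be a centre of one of the
          balls in \<open>W k\<close>, which late terms of the sequence would then enter.\<close>
        assume "g x \<notin> U"
        then have "f (max i j) x \<in> W k"
          using j[of "max i j"] g[OF x] fm[OF x]
          by (auto simp: W_def m.commute intro!: bexI[of _ "g x"])
        then show False
          using ki[of "max i j"] by simp
      qed
    qed
    then have "g -` U \<inter> space M = {x \<in> space M. \<exists>k i. \<forall>n\<ge>i. f n x \<notin> W k}"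
      by auto
    moreover have "{x \<in> space M. \<exists>k i. \<forall>n\<ge>i. f n x \<notin> W k} \<in> sets M"
    proof -
      note [measurable] = f W
      show ?thesis by measurable
    qed
    ultimately show "g -` U \<inter> space M \<in> sets M" by (rule ssubst)
  qed
qed

section \<open>Rounding of times to a grid\<close>

text \<open>Rounds down to a multiple of \<open>1/(i+1)\<close>, so only countably many times occur;
  the shift by one keeps the denominator nonzero.\<close>

definition grid :: "nat \<Rightarrow> real \<Rightarrow> real" where
  "grid i t = real_of_int \<lfloor>real (Suc i) * t\<rfloor> / real (Suc i)"

lemma grid_tendsto: "(\<lambda>i. grid i t) \<longlonglongrightarrow> t"
proof (rule tendsto_sandwich)
  have "grid i t \<le> t" "t - inverse (Suc i) \<le> grid i t" for i
  proof -
    \<comment> \<open>With a common denominator the two bounds reduce to the floor inequalities for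
      the numerators.\<close>
    have t: "t = real (Suc i) * t / real (Suc i)"
      "t - inverse (real (Suc i)) = (real (Suc i) * t - 1) / real (Suc i)"
      by (simp_all add: diff_divide_distrib inverse_eq_divide del: of_nat_Suc)
    show "grid i t \<le> t"
      unfolding grid_def by (subst (2) t(1), rule divide_right_mono) auto
    show "t - inverse (Suc i) \<le> grid i t"
      unfolding grid_def t(2) by (rule divide_right_mono) (linarith, simp)
  qed
  then show "\<forall>\<^sub>F i in sequentially. t - inverse (real (Suc i)) \<le> grid i t"
    "\<forall>\<^sub>F i in sequentially. grid i t \<le> t" by simp_all
  show "(\<lambda>i. t - inverse (real (Suc i))) \<longlonglongrightarrow> t"
    using tendsto_diff[OF tendsto_const[of t] LIMSEQ_inverse_real_of_nat] by simp
qed simp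

text \<open>On each set where the floor is constant the map depends on \<open>f\<close> alone, and
  there are countably many such sets. Measurability for each fixed time thus gives joint
  measurability of the rounded map.\<close>

lemma measurable_grid_compose:
  assumes h: "\<And>t. (\<lambda>f. h f t) \<in> M \<rightarrow>\<^sub>M N"
  shows "(\<lambda>(f, t). h f (grid i t)) \<in> M \<Otimes>\<^sub>M borel \<rightarrow>\<^sub>M N"
proof -
  have "(\<lambda>p. (\<lambda>z p. h (fst p) (real_of_int z / Suc i)) \<lfloor>real (Suc i) * snd p\<rfloor> p) \<in> M \<Otimes>\<^sub>M borel \<rightarrow>\<^sub>M N"
  proof (rule measurable_compose_countable[where g = "\<lambda>p. \<lfloor>real (Suc i) * snd p\<rfloor>"])
    show "(\<lambda>p. h (fst p) (real_of_int z / Suc i)) \<in> M \<Otimes>\<^sub>M borel \<rightarrow>\<^sub>M N" for z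
      by (rule measurable_compose[OF measurable_fst h])
    show "(\<lambda>p. \<lfloor>real (Suc i) * snd p\<rfloor>) \<in> M \<Otimes>\<^sub>M borel \<rightarrow>\<^sub>M count_space UNIV"
      by measurable
  qed
  then show ?thesis
    by (simp add: grid_def case_prod_beta')
qed

section \<open>Convergence in the path space\<close>

lemma extend_restr: "extend (restr f s) t = extend f (max s t)"
  by (simp add: extend_def[of "restr f s"] val_restr)

lemma extend_eq_val: "start f \<le> t \<Longrightarrow> extend f t = val f t"
  by (simp add: extend_def max_def)

text \<open>This is the continuity of restriction in path and time together, written for extensions.
  The error splits into the distance of \<open>F n\<close> from \<open>g\<close> at the same time,
  small by uniform convergence, and the change of \<open>g\<close> between
  \<open>max (s n) t\<close> and \<open>max a t\<close>, small by uniform continuity on a compact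
  set.\<close>

lemma uniform_limit_max_compose:
  fixes g :: "real \<Rightarrow> 'm::metric_space" and s :: "nat \<Rightarrow> real"
  assumes F: "\<And>K. compact K \<Longrightarrow> uniform_limit K F g sequentially"
    and g: "continuous_on UNIV g" and s: "s \<longlonglongrightarrow> a" and K: "compact K"
  shows "uniform_limit K (\<lambda>n t. F n (max (s n) t)) (\<lambda>t. g (max a t)) sequentially"
proof (rule uniform_limitI)
  fix e :: real assume e: "e > 0"
  obtain R1 where R1: "\<And>t. t \<in> K \<Longrightarrow> \<bar>t\<bar> \<le> R1"
    using compact_imp_bounded[OF K] by (auto simp: bounded_iff)
  obtain R2 where R2: "\<And>n. \<bar>s n\<bar> \<le> R2"
    using convergent_imp_bounded[OF s] by (auto simp: bounded_iff)
  have a: "\<bar>a\<bar> \<le> R2"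
    by (rule LIMSEQ_le_const2[OF tendsto_rabs[OF s]]) (use R2 in auto)
  \<comment> \<open>One compact interval holds all times \<open>max (s n) t\<close> and
    \<open>max a t\<close> with \<open>t\<close> in \<open>K\<close>, so that both estimates are
    uniform on it.\<close>
  define C where "C = cball (0::real) (max R1 R2)"
  have C: "compact C" by (simp add: C_def)
  have inC: "max (s n) t \<in> C" "max a t \<in> C" if "t \<in> K" for n t
    using R1[OF that] R2[of n] a by (auto simp: C_def)
  have "uniformly_continuous_on C g"
    by (intro compact_uniformly_continuous C continuous_on_subset[OF g]) auto
  then obtain d where d: "d > 0"
    "\<And>x y. x \<in> C \<Longrightarrow> y \<in> C \<Longrightarrow> dist y x < d \<Longrightarrow> dist (g y) (g x) < e / 2"
    unfolding uniformly_continuous_on_def using e by (metis half_gt_zero)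
  have "\<forall>\<^sub>F n in sequentially. dist (s n) a < d"
    using s d(1) by (auto simp: tendsto_iff)
  moreover have "\<forall>\<^sub>F n in sequentially. \<forall>y\<in>C. dist (F n y) (g y) < e / 2"
    using uniform_limitD[OF F[OF C], of "e / 2"] e by simp
  ultimately show "\<forall>\<^sub>F n in sequentially. \<forall>t\<in>K. dist (F n (max (s n) t)) (g (max a t)) < e"
  proof eventually_elim
    case (elim n)
    show ?case
    proof
      fix t assume t: "t \<in> K"
      have "dist (max (s n) t) (max a t) < d"
        using elim(1) by (auto simp: dist_real_def max_def)
      then have "dist (g (max (s n) t)) (g (max a t)) < e / 2"
        using d(2) inC[OF t] by blast
      moreover have "dist (F n (max (s n) t)) (g (max (s n) t)) < e / 2"
        using elim(2) inC[OF t] by blast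
      ultimately show "dist (F n (max (s n) t)) (g (max a t)) < e"
        by (metis dist_triangle_half_r dist_commute)
    qed
  qed
qed

locale path_space =
  fixes \<delta> :: "(real \<Rightarrow> 'm::metric_space) metric"
  assumes compact_convergence: "compact_convergence_metric \<delta>"
begin

lemma mspace_delta: "mspace \<delta> = continuous_funs"
  using compact_convergence by (simp add: compact_convergence_metric_def)

sublocale P: Metric_space UNIV "mdist (path_metric \<delta>)"
  rewrites "P.mtopology = path_topology \<delta>"
  using Metric_space_mspace_mdist[of "path_metric \<delta>"] mspace_path_metric[OF mspace_delta]
  by (auto simp: mtopology_of_def)

lemma mspace_path [simp]: "mspace (path_metric \<delta>) = UNIV"
  using mspace_path_metric[OF mspace_delta] .

text \<open>The path metric is a sum of two nonnegative terms, so it tends to 0 exactly if both do,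
  and the assumption on \<open>\<delta>\<close> translates the second into uniform convergence on
  compacts. Later arguments use \<open>\<delta>\<close> only through this description and general
  facts on metric spaces.\<close>

lemma limitin_path_iff:
  "limitin (path_topology \<delta>) F f sequentially \<longleftrightarrow>
    (\<lambda>n. start (F n)) \<longlonglongrightarrow> start f \<and>
    (\<forall>K. compact K \<longrightarrow> uniform_limit K (\<lambda>n. extend (F n)) (extend f) sequentially)"
proof -
  interpret D: Metric_space "mspace \<delta>" "mdist \<delta>"
    by (rule Metric_space_mspace_mdist)
  have e: "extend h \<in> mspace \<delta>" for h :: "'m path"
    using extend_in_continuous_funs mspace_delta by auto
  let ?a = "\<lambda>n. \<bar>start (F n) - start f\<bar>" and ?b = "\<lambda>n. mdist \<delta> (extend (F n)) (extend f)"
  have "limitin (path_topology \<delta>) F f sequentially \<longleftrightarrow> (\<lambda>n. ?a n + ?b n) \<longlonglongrightarrow> 0"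
    by (simp add: P.limitin_metric_dist_null mdist_path_metric[OF mspace_delta])
  also have "\<dots> \<longleftrightarrow> ?a \<longlonglongrightarrow> 0 \<and> ?b \<longlonglongrightarrow> 0"
  proof (intro iffI conjI)
    assume *: "(\<lambda>n. ?a n + ?b n) \<longlonglongrightarrow> 0"
    show "?a \<longlonglongrightarrow> 0" "?b \<longlonglongrightarrow> 0"
      by (rule tendsto_sandwich[OF _ _ tendsto_const *]; simp)+
  next
    assume "?a \<longlonglongrightarrow> 0 \<and> ?b \<longlonglongrightarrow> 0"
    then show "(\<lambda>n. ?a n + ?b n) \<longlonglongrightarrow> 0"
      using tendsto_add[of ?a 0 sequentially ?b 0] by simp
  qed
  also have "?a \<longlonglongrightarrow> 0 \<longleftrightarrow> (\<lambda>n. start (F n)) \<longlonglongrightarrow> start f"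
    by (simp add: tendsto_rabs_zero_iff LIM_zero_iff)
  also have "?b \<longlonglongrightarrow> 0 \<longleftrightarrow> limitin (mtopology_of \<delta>) (\<lambda>n. extend (F n)) (extend f) sequentially"
    using e by (simp add: D.limitin_metric_dist_null mtopology_of_def)
  also have "\<dots> \<longleftrightarrow> (\<forall>K. compact K \<longrightarrow> uniform_limit K (\<lambda>n. extend (F n)) (extend f) sequentially)"
    using compact_convergence[unfolded compact_convergence_metric_def, THEN conjunct2, rule_format,
        of "\<lambda>n. extend (F n)" "extend f"]
    by (simp only: extend_in_continuous_funs simp_thms)
  finally show ?thesis .
qed

lemmas tendsto_start = limitin_path_iff[THEN iffD1, THEN conjunct1]

lemmas uniform_limit_extend = limitin_path_iff[THEN iffD1, THEN conjunct2, rule_format]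

lemma limitin_restr:
  assumes "limitin (path_topology \<delta>) F f sequentially" "s \<longlonglongrightarrow> a"
  shows "limitin (path_topology \<delta>) (\<lambda>n. restr (F n) (s n)) (restr f a) sequentially"
proof -
  have "uniform_limit K (\<lambda>n t. extend (F n) (max (s n) t)) (\<lambda>t. extend f (max a t)) sequentially"
    if "compact K" for K
    by (rule uniform_limit_max_compose[OF _ continuous_on_extend assms(2) that])
       (rule uniform_limit_extend[OF assms(1)])
  then show ?thesis
    using assms(2) by (simp add: limitin_path_iff extend_restr[abs_def])
qed

text \<open>Left of its start \<open>restr (F n) (s n)\<close> extends constantly by the value
  \<open>extend (F n) (s n)\<close>. Evaluation at the moving times \<open>s n\<close> is thus
  evaluation of the restrictions at one fixed time, the lower bound \<open>- R\<close>.\<close>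

lemma tendsto_extend:
  assumes F: "limitin (path_topology \<delta>) F f sequentially" and s: "s \<longlonglongrightarrow> a"
  shows "(\<lambda>n. extend (F n) (s n)) \<longlonglongrightarrow> extend f a"
proof -
  obtain R where R: "\<And>n. \<bar>s n\<bar> \<le> R"
    using convergent_imp_bounded[OF s] by (auto simp: bounded_iff)
  have "\<bar>a\<bar> \<le> R"
    by (rule LIMSEQ_le_const2[OF tendsto_rabs[OF s]]) (use R in auto)
  then have a: "max a (- R) = a" by linarith
  have sR: "max (s n) (- R) = s n" for n
    using R[of n] by linarith
  have "uniform_limit {- R} (\<lambda>n. extend (restr (F n) (s n))) (extend (restr f a)) sequentially"
    by (rule uniform_limit_extend[OF limitin_restr[OF F s]]) simp
  then have "(\<lambda>n. extend (restr (F n) (s n)) (- R)) \<longlonglongrightarrow> extend (restr f a) (- R)"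
    by (rule tendsto_uniform_limitI) simp
  then show ?thesis
    by (simp add: extend_restr a sR)
qed

section \<open>Measurability of evaluation and restriction of paths\<close>

lemma space_path_borel [simp]: "space (path_borel \<delta>) = UNIV"
  by (simp add: path_borel_def)

lemma sets_path_borel: "openin (path_topology \<delta>) U \<Longrightarrow> U \<in> sets (path_borel \<delta>)"
  by (simp add: path_borel_def)

text \<open>The source is a metric space, so closedness of a preimage can be tested on sequences.
  The target \<open>T\<close> is left general to serve both \<open>euclidean\<close> and the path
  topology.\<close>

lemma continuous_map_path_sequentiallyI:
  assumes "\<And>F f. limitin (path_topology \<delta>) F f sequentially \<Longrightarrow>
             limitin T (\<lambda>n. h (F n)) (h f) sequentially"
  shows "continuous_map (path_topology \<delta>) T h"
  unfolding continuous_map_closedin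
proof (intro conjI allI impI)
  \<comment> \<open>Constant sequences show that \<open>h\<close> takes its values in the topspace
    of \<open>T\<close>.\<close>
  have "limitin (path_topology \<delta>) (\<lambda>_. f) f sequentially" for f
    by (simp add: limitin_const_iff)
  then have "limitin T (\<lambda>_. h f) (h f) sequentially" for f
    using assms[of "\<lambda>_. f" f] by blast
  then show "h \<in> topspace (path_topology \<delta>) \<rightarrow> topspace T"
    by (auto simp: limitin_def)
  fix C assume C: "closedin T C"
  have "f \<in> {f. h f \<in> C}"
    if "range F \<subseteq> {f. h f \<in> C}" "limitin (path_topology \<delta>) F f sequentially" for F f
    using limitin_closedin[OF assms[OF that(2)] C] that(1) by (auto simp: subset_iff)
  then show "closedin (path_topology \<delta>) {f \<in> topspace (path_topology \<delta>). h f \<in> C}"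
    unfolding P.metric_closedin_iff_sequentially_closed by auto
qed

lemma measurable_euclidean_of_continuous_map:
  fixes h :: "'m path \<Rightarrow> 'b::topological_space"
  assumes "continuous_map (path_topology \<delta>) euclidean h"
  shows "h \<in> borel_measurable (path_borel \<delta>)"
proof (rule borel_measurableI)
  fix S :: "'b set" assume "open S"
  then have "openin (path_topology \<delta>) {f \<in> topspace (path_topology \<delta>). h f \<in> S}"
    using assms by (auto simp: continuous_map_def)
  then show "h -` S \<inter> space (path_borel \<delta>) \<in> sets (path_borel \<delta>)"
    by (auto intro!: sets_path_borel simp: vimage_def)
qed

lemma measurable_start [measurable]: "start \<in> borel_measurable (path_borel \<delta>)"
  by (rule measurable_euclidean_of_continuous_map[OF continuous_map_path_sequentiallyI])
     (unfold limitin_canonical_iff, rule tendsto_start)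

lemma measurable_extend_at: "(\<lambda>f. extend f t) \<in> borel_measurable (path_borel \<delta>)"
  by (rule measurable_euclidean_of_continuous_map[OF continuous_map_path_sequentiallyI])
     (unfold limitin_canonical_iff, rule tendsto_extend[OF _ tendsto_const])

text \<open>Evaluation goes through \<open>extend\<close>, since \<open>val f t\<close> is
  meaningful only for \<open>t \<ge> start f\<close>; \<open>extend f\<close> is continuous at every
  real time, so the values at the rounded times converge.\<close>

lemma measurable_extend:
  "(\<lambda>(f, t). extend f t) \<in> borel_measurable (path_borel \<delta> \<Otimes>\<^sub>M borel)"
proof (rule borel_measurable_LIMSEQ_metric)
  show "(\<lambda>(f, t). extend f (grid i t)) \<in> borel_measurable (path_borel \<delta> \<Otimes>\<^sub>M borel)" for i
    by (rule measurable_grid_compose[OF measurable_extend_at])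
  have "(\<lambda>i. extend f (grid i t)) \<longlonglongrightarrow> extend f t" for f :: "'m path" and t
    by (rule tendsto_extend[OF _ grid_tendsto]) (simp add: limitin_const_iff)
  then show "(\<lambda>i. case p of (f, t) \<Rightarrow> extend f (grid i t)) \<longlonglongrightarrow> (case p of (f, t) \<Rightarrow> extend f t)"
    for p :: "'m path \<times> real" by (simp split: prod.splits)
qed

lemma measurable_restr_at: "(\<lambda>f. restr f t) \<in> path_borel \<delta> \<rightarrow>\<^sub>M path_borel \<delta>"
proof -
  have c: "continuous_map (path_topology \<delta>) (path_topology \<delta>) (\<lambda>f. restr f t)"
    by (rule continuous_map_path_sequentiallyI) (rule limitin_restr[OF _ tendsto_const])
  have "(\<lambda>f. restr f t) -` U \<inter> space (path_borel \<delta>) \<in> sets (path_borel \<delta>)"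
    if "openin (path_topology \<delta>) U" for U
    using openin_continuous_map_preimage[OF c that] by (auto intro!: sets_path_borel simp: vimage_def)
  then show ?thesis
    by (subst (2) path_borel_def, intro measurable_measure_of) auto
qed

text \<open>The approximation is as for \<open>measurable_extend\<close>, but the limit is
  path-valued: convergence comes from \<open>limitin_restr\<close>, measurability of the limit from
  \<open>measurable_limitin_metric\<close>.\<close>

lemma measurable_restr:
  "(\<lambda>(f, t). restr f t) \<in> path_borel \<delta> \<Otimes>\<^sub>M borel \<rightarrow>\<^sub>M path_borel \<delta>"
proof -
  have N: "path_borel \<delta> = sigma (mspace (path_metric \<delta>)) {U. openin (path_topology \<delta>) U}"
    by (simp add: path_borel_def)
  have m: "(\<lambda>(f, t). restr f (grid i t)) \<in> path_borel \<delta> \<Otimes>\<^sub>M borel \<rightarrow>\<^sub>M path_borel \<delta>" for i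
    by (rule measurable_grid_compose[OF measurable_restr_at])
  have "limitin (path_topology \<delta>) (\<lambda>i. restr f (grid i t)) (restr f t) sequentially" for f t
    by (rule limitin_restr[OF _ grid_tendsto]) (simp add: limitin_const_iff)
  then have "limitin (path_topology \<delta>) (\<lambda>i. case p of (f, t) \<Rightarrow> restr f (grid i t))
      (case p of (f, t) \<Rightarrow> restr f t) sequentially" for p
    by (simp split: prod.splits)
  with m show ?thesis
    using measurable_limitin_metric[of "\<lambda>i (f, t). restr f (grid i t)" "path_borel \<delta> \<Otimes>\<^sub>M borel"
      "path_metric \<delta>" "\<lambda>(f, t). restr f t"] unfolding N[symmetric] by blast
qed

lemma measurable_skeleton_component:
  "(\<lambda>\<phi>. \<phi> n) \<in> skeleton_space \<delta> \<rightarrow>\<^sub>M path_borel \<delta>"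
  unfolding skeleton_space_def path_seq_space_def
  by (intro measurable_restrict_space1 measurable_component_singleton) simp

section \<open>Relative compactness in the path space\<close>

lemma relatively_compact_subset:
  assumes "relatively_compact_in (path_topology \<delta>) S" "T \<subseteq> S"
  shows "relatively_compact_in (path_topology \<delta>) T"
  using assms closed_compactin[OF _ closure_of_mono[OF assms(2)] closedin_closure_of]
  by (simp add: relatively_compact_in_def)

lemma relatively_compact_convergent_subsequence:
  fixes F :: "nat \<Rightarrow> 'm path"
  assumes "relatively_compact_in (path_topology \<delta>) S" "range F \<subseteq> S"
  obtains r f where "strict_mono (r :: nat \<Rightarrow> nat)" "limitin (path_topology \<delta>) (F \<circ> r) f sequentially"
proof -
  have "S \<subseteq> path_topology \<delta> closure_of S"
    by (rule closure_of_subset) simp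
  with assms(2) have "range F \<subseteq> path_topology \<delta> closure_of S"
    by (rule subset_trans)
  moreover have "compactin (path_topology \<delta>) (path_topology \<delta> closure_of S)"
    using assms(1) by (simp only: relatively_compact_in_def)
  ultimately have "\<exists>f r. f \<in> path_topology \<delta> closure_of S \<and> strict_mono (r :: nat \<Rightarrow> nat) \<and>
      limitin (path_topology \<delta>) (F \<circ> r) f sequentially"
    by (intro P.compactin_sequentially[THEN iffD1, THEN conjunct2, rule_format])
  then show ?thesis using that by (elim exE conjE)
qed

end

section \<open>The conditions on a skeleton as separate rules, and first consequences\<close>

lemma skeletons_coalesce:
  assumes "\<phi> \<in> skeletons \<delta>" "m \<in> started \<phi> s" "n \<in> started \<phi> s" "val (\<phi> m) s = val (\<phi> n) s" "s \<le> t"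
  shows "val (\<phi> m) t = val (\<phi> n) t"
  by (rule assms(1)[unfolded skeletons_def mem_Collect_eq, THEN conjunct1, rule_format, OF assms(2-5)])

lemma skeletons_dense:
  assumes "\<phi> \<in> skeletons \<delta>" "open U" "U \<noteq> {}"
  obtains n where "(start (\<phi> n), val (\<phi> n) (start (\<phi> n))) \<in> U"
proof -
  have "closure (range (\<lambda>n. (start (\<phi> n), val (\<phi> n) (start (\<phi> n))))) = UNIV"
    by (rule assms(1)[unfolded skeletons_def mem_Collect_eq, THEN conjunct2, THEN conjunct1])
  then have "U \<inter> range (\<lambda>n. (start (\<phi> n), val (\<phi> n) (start (\<phi> n)))) \<noteq> {}"
    using assms(2,3) open_Int_closure_eq_empty[of U] by auto
  then show ?thesis using that by blast
qed

lemma skeletons_relatively_compact: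
  assumes "\<phi> \<in> skeletons \<delta>" "compact L"
  shows "relatively_compact_in (path_topology \<delta>)
     {restr (\<phi> n) s | n s. n \<in> started \<phi> s \<and> (s, val (\<phi> n) s) \<in> L}"
  by (rule assms(1)[unfolded skeletons_def mem_Collect_eq, THEN conjunct2, THEN conjunct2, rule_format,
        OF assms(2)])

text \<open>Both restrictions start at \<open>s\<close> and extend constantly before
  \<open>s\<close>, so coalescence from \<open>s\<close> on makes them equal as paths.\<close>

lemma restr_cong_skeleton:
  assumes "\<phi> \<in> skeletons \<delta>" "m \<in> started \<phi> s" "n \<in> started \<phi> s" "val (\<phi> m) s = val (\<phi> n) s"
  shows "restr (\<phi> m) s = restr (\<phi> n) s"
proof (rule path_eqI)
  show "extend (restr (\<phi> m) s) = extend (restr (\<phi> n) s)"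
    using skeletons_coalesce[OF assms] assms(2,3)
    by (auto simp: fun_eq_iff extend_restr extend_eq_val started_def)
qed simp

text \<open>Paths started shortly before \<open>s\<close> near \<open>x\<close> are relatively compact, so a subsequence of them
  converges to a path from \<open>(s,x)\<close>; hence they are still near \<open>x\<close> at time \<open>s\<close>.\<close>

lemma index_set_nonempty:
  fixes \<delta> :: "(real \<Rightarrow> 'm::heine_borel) metric"
  assumes "compact_convergence_metric \<delta>" and \<phi>: "\<phi> \<in> skeletons \<delta>" and e: "e > 0"
  obtains n where "n \<in> started \<phi> s" "dist (val (\<phi> n) s) x < e"
proof -
  interpret path_space \<delta> by standard fact
  define S where "S n = start (\<phi> n)" for n
  define X where "X n = val (\<phi> n) (S n)" for n
  \<comment> \<open>Asking for a start strictly before \<open>s\<close> keeps the rectangle open, so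
    density applies, and puts the index into \<open>started \<phi> s\<close>.\<close>
  have "\<exists>n. (S n, X n) \<in> {s - inverse (Suc j) <..< s} \<times> ball x (inverse (Suc j))" for j
    by (rule skeletons_dense[OF \<phi>, of "{s - inverse (Suc j) <..< s} \<times> ball x (inverse (Suc j))"])
       (auto simp: open_Times S_def X_def)
  then obtain n where n: "\<And>j. (S (n j), X (n j)) \<in> {s - inverse (Suc j) <..< s} \<times> ball x (inverse (Suc j))"
    by metis
  have S: "(\<lambda>j. S (n j)) \<longlonglongrightarrow> s"
  proof (rule tendsto_sandwich)
    show "(\<lambda>j. s - inverse (real (Suc j))) \<longlonglongrightarrow> s"
      using tendsto_diff[OF tendsto_const[of s] LIMSEQ_inverse_real_of_nat] by simp
  qed (use n in \<open>auto intro!: always_eventually less_imp_le simp del: of_nat_Suc\<close>)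
  have X: "(\<lambda>j. X (n j)) \<longlonglongrightarrow> x"
  proof (rule metric_tendsto_imp_tendsto[OF LIMSEQ_inverse_real_of_nat])
    show "\<forall>\<^sub>F j in sequentially. dist (X (n j)) x \<le> dist (inverse (real (Suc j))) 0"
      using n by (auto intro!: always_eventually less_imp_le simp: dist_commute simp del: of_nat_Suc)
  qed
  \<comment> \<open>The radii \<open>inverse (Suc j)\<close> are at most 1, so \<open>L\<close>
    contains every chosen starting point; condition (3) is applied at the varying times
    \<open>S (n j)\<close>.\<close>
  define L where "L = {s - 1..s} \<times> cball x 1"
  have "compact L" by (simp add: L_def compact_Times)
  moreover have inL: "(S (n j), X (n j)) \<in> L" for j
  proof -
    have "inverse (real (Suc j)) \<le> 1" by (simp add: field_simps)
    then show ?thesis using n[of j] unfolding L_def by auto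
  qed
  ultimately obtain r f where r: "strict_mono r"
    and f: "limitin (path_topology \<delta>) ((\<lambda>j. restr (\<phi> (n j)) (S (n j))) \<circ> r) f sequentially"
    using relatively_compact_convergent_subsequence[OF skeletons_relatively_compact[OF \<phi>],
      of L "\<lambda>j. restr (\<phi> (n j)) (S (n j))"]
    unfolding X_def S_def started_def by blast
  have Sr: "(\<lambda>j. S (n (r j))) \<longlonglongrightarrow> s" and Xr: "(\<lambda>j. X (n (r j))) \<longlonglongrightarrow> x"
    using LIMSEQ_subseq_LIMSEQ[OF S r] LIMSEQ_subseq_LIMSEQ[OF X r] by (simp_all add: o_def)
  \<comment> \<open>The subsequence is evaluated twice: at the moving starting times, which
    identifies \<open>extend f s\<close> as \<open>x\<close>, and then at the fixed time
    \<open>s\<close>.\<close>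
  have "(\<lambda>j. X (n (r j))) \<longlonglongrightarrow> extend f s"
    using tendsto_extend[OF f Sr] by (simp add: extend_restr extend_eq_val X_def S_def)
  then have "extend f s = x" using Xr LIMSEQ_unique by blast
  then have "(\<lambda>j. val (\<phi> (n (r j))) s) \<longlonglongrightarrow> x"
    using tendsto_extend[OF f tendsto_const[of s]] n
    by (simp add: extend_restr extend_eq_val S_def max_absorb2 less_imp_le)
  then obtain j where "dist (val (\<phi> (n (r j))) s) x < e"
    using e by (auto simp: tendsto_iff eventually_sequentially)
  moreover have "n (r j) \<in> started \<phi> s"
    using n[of "r j"] by (auto simp: started_def S_def)
  ultimately show ?thesis using that by blast
qed

section \<open>The selected index and measurability of \<open>Theta\<close>\<close>

lemma index_least:
  "n \<in> started \<phi> s \<Longrightarrow> dist (val (\<phi> n) s) x < \<epsilon> k x \<Longrightarrow> index \<epsilon> s x \<phi> k \<le> n"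
  by (simp add: index_def cInf_lower)

text \<open>The index set is nonempty by \<open>index_set_nonempty\<close>, so \<open>Inf\<close> is
  an attained minimum and not a default value.\<close>

lemma index_props:
  fixes \<delta> :: "(real \<Rightarrow> 'm::heine_borel) metric"
  assumes "compact_convergence_metric \<delta>" "\<phi> \<in> skeletons \<delta>" "\<epsilon> k x > 0"
  shows "index \<epsilon> s x \<phi> k \<in> started \<phi> s"
    and "dist (val (\<phi> (index \<epsilon> s x \<phi> k)) s) x < \<epsilon> k x"
proof -
  have "{n \<in> started \<phi> s. dist (val (\<phi> n) s) x < \<epsilon> k x} \<noteq> {}"
    using index_set_nonempty[OF assms] by blast
  from Inf_nat_def1[OF this]
  show "index \<epsilon> s x \<phi> k \<in> started \<phi> s"
    "dist (val (\<phi> (index \<epsilon> s x \<phi> k)) s) x < \<epsilon> k x"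
    by (auto simp: index_def)
qed

lemma measurable_index:
  fixes \<delta> :: "(real \<Rightarrow> 'm::{polish_space, heine_borel}) metric"
  assumes "compact_convergence_metric \<delta>" and [measurable]: "\<epsilon> k \<in> borel_measurable borel"
  shows "(\<lambda>(s, x, \<phi>). index \<epsilon> s x \<phi> k)
    \<in> borel \<Otimes>\<^sub>M (borel \<Otimes>\<^sub>M skeleton_space \<delta>) \<rightarrow>\<^sub>M count_space UNIV"
proof -
  interpret path_space \<delta> by standard fact
  let ?M = "borel \<Otimes>\<^sub>M (borel \<Otimes>\<^sub>M skeleton_space \<delta>) :: (real \<times> 'm \<times> (nat \<Rightarrow> 'm path)) measure"
  note [measurable] = measurable_skeleton_component
  have [measurable]: "(\<lambda>p. extend (snd (snd p) n) (fst p)) \<in> borel_measurable ?M" for n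
    using measurable_compose[OF _ measurable_extend, of "\<lambda>p. (snd (snd p) n, fst p)" ?M] by simp
  \<comment> \<open>On natural numbers \<open>Inf\<close> is \<open>LEAST\<close>, and under the
    first conjunct \<open>val\<close> may be replaced by the jointly measurable
    \<open>extend\<close>. The condition is then measurable for each \<open>n\<close>.\<close>
  have eq: "(\<lambda>(s, x, \<phi>). index \<epsilon> s x \<phi> k) =
    (\<lambda>p. LEAST n. start (snd (snd p) n) \<le> fst p \<and>
      dist (extend (snd (snd p) n) (fst p)) (fst (snd p)) < \<epsilon> k (fst (snd p)))"
    by (auto simp: fun_eq_iff index_def Inf_nat_def started_def extend_eq_val
        intro!: arg_cong[of _ _ Least] split: prod.splits)
  show ?thesis unfolding eq by measurable
qed

lemma measurable_Theta:
  fixes \<delta> :: "(real \<Rightarrow> 'm::{polish_space, heine_borel}) metric"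
  assumes "compact_convergence_metric \<delta>" and lp: "lp \<in> path_seq_space \<delta> \<rightarrow>\<^sub>M path_borel \<delta>"
    and \<epsilon>: "\<And>k. \<epsilon> k \<in> borel_measurable borel"
  shows "(\<lambda>(s, x, \<phi>). Theta lp \<epsilon> s x \<phi>)
    \<in> borel \<Otimes>\<^sub>M (borel \<Otimes>\<^sub>M skeleton_space \<delta>) \<rightarrow>\<^sub>M path_borel \<delta>"
proof -
  interpret path_space \<delta> by standard fact
  let ?M = "borel \<Otimes>\<^sub>M (borel \<Otimes>\<^sub>M skeleton_space \<delta>) :: (real \<times> 'm \<times> (nat \<Rightarrow> 'm path)) measure"
  note [measurable] = measurable_skeleton_component
  have r: "(\<lambda>p. restr (snd (snd p) n) (fst p)) \<in> ?M \<rightarrow>\<^sub>M path_borel \<delta>" for n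
    using measurable_compose[OF _ measurable_restr, of "\<lambda>p. (snd (snd p) n, fst p)" ?M] by simp
  \<comment> \<open>The index takes countably many values, so the maps in \<open>r\<close> for fixed
    \<open>n\<close> are pasted along it. Measurability into the sequence space is then checked
    coordinatewise in \<open>k\<close>.\<close>
  have "(\<lambda>p. restr (snd (snd p) (index \<epsilon> (fst p) (fst (snd p)) (snd (snd p)) k)) (fst p))
      \<in> ?M \<rightarrow>\<^sub>M path_borel \<delta>" for k
    using measurable_compose_countable[OF r measurable_index[where k = k, OF assms(1) \<epsilon>]]
    by (simp add: case_prod_beta)
  then have "(\<lambda>p k. restr (snd (snd p) (index \<epsilon> (fst p) (fst (snd p)) (snd (snd p)) k)) (fst p))
      \<in> ?M \<rightarrow>\<^sub>M path_seq_space \<delta>"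
    unfolding path_seq_space_def by (intro measurable_PiM_single') (auto simp: space_PiM)
  from measurable_compose[OF this lp] show ?thesis
    by (simp add: Theta_def case_prod_beta')
qed

section \<open>Properties (a) and (b) of \<open>Theta\<close>\<close>

text \<open>Since the radii decrease, all selected paths pass at time \<open>s\<close> through the
  closed ball of radius \<open>\<epsilon> 0 x\<close>, compact because closed balls of the state
  space are. Condition (3) then makes them relatively compact, so the assumption on
  \<open>lp\<close> applies.\<close>

lemma approximants_limit_point:
  fixes \<delta> :: "(real \<Rightarrow> 'm::heine_borel) metric"
  assumes ccm: "compact_convergence_metric \<delta>"
    and lp: "\<And>f :: nat \<Rightarrow> 'm path. relatively_compact_in (path_topology \<delta>) (range f) \<Longrightarrow>
           seq_limit_point (path_topology \<delta>) f (lp f)"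
    and pos: "\<And>k. \<epsilon> k x > 0" and dec: "decseq (\<lambda>k. \<epsilon> k x)"
    and \<phi>: "\<phi> \<in> skeletons \<delta>"
  obtains r where "strict_mono (r :: nat \<Rightarrow> nat)"
    "limitin (path_topology \<delta>) (\<lambda>k. restr (\<phi> (index \<epsilon> s x \<phi> (r k))) s) (Theta lp \<epsilon> s x \<phi>) sequentially"
proof -
  interpret path_space \<delta> by standard fact
  note ix = index_props[OF ccm \<phi>, where \<epsilon> = \<epsilon>, OF pos]
  let ?F = "\<lambda>k. restr (\<phi> (index \<epsilon> s x \<phi> k)) s"
  define L where "L = {s} \<times> cball x (\<epsilon> 0 x)"
  have "compact L" by (simp add: L_def compact_Times)
  moreover have "(s, val (\<phi> (index \<epsilon> s x \<phi> k)) s) \<in> L" for k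
    using ix(2)[of s k] decseqD[OF dec, of 0 k] by (auto simp: L_def dist_commute)
  then have "range ?F \<subseteq> {restr (\<phi> n) s | n s. n \<in> started \<phi> s \<and> (s, val (\<phi> n) s) \<in> L}"
    using ix(1) by blast
  ultimately have "relatively_compact_in (path_topology \<delta>) (range ?F)"
    using relatively_compact_subset skeletons_relatively_compact[OF \<phi>] by blast
  from lp[OF this] show ?thesis
    using that by (auto simp: seq_limit_point_def Theta_def o_def)
qed

text \<open>All approximants start at \<open>s\<close>, hence so does their limit. Their values at
  \<open>s\<close> tend to \<open>x\<close> because they are within \<open>\<epsilon> k x\<close> of
  it, and to the value of the limit by continuity of evaluation.\<close>

lemma Theta_start_val:
  fixes \<delta> :: "(real \<Rightarrow> 'm::heine_borel) metric"
  assumes ccm: "compact_convergence_metric \<delta>"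
    and lp: "\<And>f :: nat \<Rightarrow> 'm path. relatively_compact_in (path_topology \<delta>) (range f) \<Longrightarrow>
           seq_limit_point (path_topology \<delta>) f (lp f)"
    and pos: "\<And>k. \<epsilon> k x > 0" and dec: "decseq (\<lambda>k. \<epsilon> k x)" and lim: "(\<lambda>k. \<epsilon> k x) \<longlonglongrightarrow> 0"
    and \<phi>: "\<phi> \<in> skeletons \<delta>"
  shows "start (Theta lp \<epsilon> s x \<phi>) = s" and "val (Theta lp \<epsilon> s x \<phi>) s = x"
proof -
  interpret path_space \<delta> by standard fact
  note ix = index_props[OF ccm \<phi>, where \<epsilon> = \<epsilon>, OF pos]
  obtain r where r: "strict_mono r" and l: "limitin (path_topology \<delta>)
      (\<lambda>k. restr (\<phi> (index \<epsilon> s x \<phi> (r k))) s) (Theta lp \<epsilon> s x \<phi>) sequentially"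
    by (rule approximants_limit_point[where lp = lp and \<epsilon> = \<epsilon> and x = x, OF ccm lp pos dec \<phi>])
  show st: "start (Theta lp \<epsilon> s x \<phi>) = s"
    using tendsto_start[OF l] by (simp add: LIMSEQ_const_iff)
  have "(\<lambda>k. val (\<phi> (index \<epsilon> s x \<phi> k)) s) \<longlonglongrightarrow> x"
    by (rule metric_tendsto_imp_tendsto[OF lim])
       (use ix(2) pos in \<open>auto intro!: always_eventually less_imp_le simp: abs_of_pos\<close>)
  from LIMSEQ_subseq_LIMSEQ[OF this r]
  have "(\<lambda>k. val (\<phi> (index \<epsilon> s x \<phi> (r k))) s) \<longlonglongrightarrow> x"
    by (simp add: o_def)
  moreover have "(\<lambda>k. val (\<phi> (index \<epsilon> s x \<phi> (r k))) s) \<longlonglongrightarrow> val (Theta lp \<epsilon> s x \<phi>) s"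
    using tendsto_extend[OF l tendsto_const[of s]] ix(1) st
    by (simp add: extend_restr extend_eq_val started_def)
  ultimately show "val (Theta lp \<epsilon> s x \<phi>) s = x"
    using LIMSEQ_unique by blast
qed

lemma Theta_skeleton_path:
  fixes \<delta> :: "(real \<Rightarrow> 'm::heine_borel) metric"
  assumes ccm: "compact_convergence_metric \<delta>"
    and lp: "\<And>f :: nat \<Rightarrow> 'm path. relatively_compact_in (path_topology \<delta>) (range f) \<Longrightarrow>
           seq_limit_point (path_topology \<delta>) f (lp f)"
    and pos: "\<And>k x. \<epsilon> k x > 0" and dec: "\<And>x. decseq (\<lambda>k. \<epsilon> k x)"
    and lim: "\<And>x. (\<lambda>k. \<epsilon> k x) \<longlonglongrightarrow> 0"
    and \<phi>: "\<phi> \<in> skeletons \<delta>" and n: "n \<in> started \<phi> s"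
  shows "Theta lp \<epsilon> s (val (\<phi> n) s) \<phi> = restr (\<phi> n) s"
proof -
  interpret path_space \<delta> by standard fact
  define x where "x = val (\<phi> n) s"
  note ix = index_props[OF ccm \<phi>, where \<epsilon> = \<epsilon> and x = x, OF pos]
  obtain r where r: "strict_mono r" and l: "limitin (path_topology \<delta>)
      (\<lambda>k. restr (\<phi> (index \<epsilon> s x \<phi> (r k))) s) (Theta lp \<epsilon> s x \<phi>) sequentially"
    by (rule approximants_limit_point[where lp = lp and \<epsilon> = \<epsilon> and x = x, OF ccm lp pos dec \<phi>])
  \<comment> \<open>All indices are at most \<open>n\<close>, so once \<open>\<epsilon> k x\<close> is below the distance from \<open>x\<close> of the values
    \<open>\<phi>\<^sub>m(s) \<noteq> x\<close> with \<open>m \<le> n\<close>, the selected path passes through \<open>x\<close> itself.\<close>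
  have le: "index \<epsilon> s x \<phi> k \<le> n" for k
    by (rule index_least[OF n]) (simp add: x_def[symmetric] pos)
  have "\<forall>\<^sub>F k in sequentially. val (\<phi> m) s \<noteq> x \<longrightarrow> \<epsilon> k x < dist (val (\<phi> m) s) x" for m
    using order_tendstoD(2)[OF lim[of x], of "dist (val (\<phi> m) s) x"]
    by (cases "val (\<phi> m) s = x") auto
  \<comment> \<open>Only finitely many \<open>m\<close> compete, so their separate thresholds for
    \<open>k\<close> have a common bound.\<close>
  then have "\<forall>\<^sub>F k in sequentially. \<forall>m\<in>{..n}. val (\<phi> m) s \<noteq> x \<longrightarrow> \<epsilon> k x < dist (val (\<phi> m) s) x"
    by (intro eventually_ball_finite) auto
  then have "\<forall>\<^sub>F k in sequentially. restr (\<phi> (index \<epsilon> s x \<phi> k)) s = restr (\<phi> n) s"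
  proof eventually_elim
    case (elim k)
    have "val (\<phi> (index \<epsilon> s x \<phi> k)) s = x"
      using bspec[OF elim, of "index \<epsilon> s x \<phi> k"] le[of k] ix(2)[of s k] by auto
    then show ?case
      using restr_cong_skeleton[OF \<phi> ix(1) n] by (simp add: x_def)
  qed
  \<comment> \<open>An eventually constant sequence stays so along \<open>r\<close>, and uniqueness
    of limits identifies the constant with \<open>Theta\<close>.\<close>
  then have "\<forall>\<^sub>F k in sequentially. restr (\<phi> (index \<epsilon> s x \<phi> (r k))) s = restr (\<phi> n) s"
    by (rule eventually_subseq[OF r])
  then have "limitin (path_topology \<delta>) (\<lambda>k. restr (\<phi> (index \<epsilon> s x \<phi> (r k))) s) (restr (\<phi> n) s) sequentially"
    by (auto intro: limitin_eventually)
  then show ?thesis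
    using P.limitin_metric_unique[OF l] by (simp add: x_def)
qed

theorem theorem2p3:
  fixes \<delta> :: "(real \<Rightarrow> 'm::{polish_space, heine_borel}) metric"
    and lp :: "(nat \<Rightarrow> 'm path) \<Rightarrow> 'm path"
    and \<epsilon> :: "nat \<Rightarrow> 'm \<Rightarrow> real"
  assumes "compact_convergence_metric \<delta>"
    and "mcomplete_of (path_metric \<delta>)"
    and "separable_space (path_topology \<delta>)"
    and "lp \<in> path_seq_space \<delta> \<rightarrow>\<^sub>M path_borel \<delta>"
    and "\<And>f :: nat \<Rightarrow> 'm path. relatively_compact_in (path_topology \<delta>) (range f) \<Longrightarrow>
           seq_limit_point (path_topology \<delta>) f (lp f)"
    and "\<And>k. \<epsilon> k \<in> borel_measurable borel"
    and "\<And>k x. \<epsilon> k x > 0"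
    and "\<And>x. decseq (\<lambda>k. \<epsilon> k x)"
    and "\<And>x. (\<lambda>k. \<epsilon> k x) \<longlonglongrightarrow> 0"
  shows "(\<lambda>(s, x, \<phi>). Theta lp \<epsilon> s x \<phi>)
           \<in> borel \<Otimes>\<^sub>M (borel \<Otimes>\<^sub>M skeleton_space \<delta>) \<rightarrow>\<^sub>M path_borel \<delta> \<and>
         (\<forall>s. \<forall>\<phi> \<in> skeletons \<delta>.
           (\<forall>x. start (Theta lp \<epsilon> s x \<phi>) = s \<and> val (Theta lp \<epsilon> s x \<phi>) s = x) \<and>
           (\<forall>n \<in> started \<phi> s. Theta lp \<epsilon> s (val (\<phi> n) s) \<phi> = restr (\<phi> n) s))"
  by (intro conjI allI ballI measurable_Theta[OF assms(1,4,6)]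
      Theta_start_val[where lp = lp and \<epsilon> = \<epsilon>, OF assms(1,5,7-9)]
      Theta_skeleton_path[where lp = lp and \<epsilon> = \<epsilon>, OF assms(1,5,7-9)])

end
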